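(* Let $X=(X,\succcurlyeq_X)$ and $Y=(Y,\succcurlyeq_Y)$ be two partially ordered metric spaces. Assume that there exists a geodesic ray $\sigma:[0,\infty)\to Y$ such that (a) $\sigma(s)\succcurlyeq_Y\sigma(t)$ whenever $s\geq t\geq 0$; and (b) the Busemann function $B_\sigma$ associated with $\sigma$ is $\succcurlyeq_Y$-decreasing. If $(X,Y)$ has the monotone Lipschitz extension property, then $\succcurlyeq_X$ is radial.
   Context: A partially ordered metric space is a (nonempty) metric space together with a partial order (reflexive, transitive, antisymmetric relation) on it; no compatibility between metric and order is assumed. For a partial order $\succcurlyeq$: $x\succ y$ means $x\succcurlyeq y$ and $x\neq y$; $x\succcurlyeq^{\bullet}y$ means that $y\succcurlyeq x$ does not hold. A partial order $\succcurlyeq$ on a metric space $(X,d)$ is radial if for all $x,y,z\in X$: (i) $x\succcurlyeq^{\bullet}y\succ z$ implies $d(x,z)\geq d(x,y)$; and (ii) $x\succ y\succcurlyeq^{\bullet}z$ implies $d(x,z)\geq d(y,z)$. A geodesic ray in $Y$ is a map $\sigma:[0,\infty)\to Y$ with $d_Y(\sigma(s),\sigma(t))=|s-t|$ for all $s,t\geq 0$. Its Busemann function is $B_\sigma:Y\to\mathbb{R}$, $B_\sigma(a):=\lim_{t\to\infty}(d_Y(a,\sigma(t))-t)$ (the limit always exists). $B_\sigma$ is $\succcurlyeq_Y$-decreasing if $a\succcurlyeq_Y b$ implies $B_\sigma(a)\leq B_\sigma(b)$. A map $f$ between partially ordered sets is order-preserving if $x\succcurlyeq_X y$ implies $f(x)\succcurlyeq_Y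 f(y)$; a map between metric spaces is 1-Lipschitz if $d_Y(f(x),f(y))\leq d_X(x,y)$ for all $x,y$. The pair $(X,Y)$ has the monotone Lipschitz extension property if for every nonempty $S\subseteq X$ (with the induced metric and order) and every order-preserving 1-Lipschitz map $f:S\to Y$, there is an order-preserving 1-Lipschitz map $F:X\to Y$ with $F|_S=f$. *)

theory Defs
  imports "HOL-Analysis.Analysis"
begin

text \<open>
  An order is an explicit relation with \<open>ge x y\<close> read as ``\<open>x\<close> is above or equal to \<open>y\<close>''.
  Metric axioms are those of \<open>Metric_space\<close>, whose symmetry and nonnegativity conditions range over the
  whole type; this is no restriction, as any metric on \<open>M\<close> extends by \<open>0\<close>. Everything else is
  constrained only on the carriers.
\<close>

locale partially_ordered_metric_space = Metric_space M d
  for M :: "'a set" and d :: "'a \<Rightarrow> 'a \<Rightarrow> real" +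
  fixes ge :: "'a \<Rightarrow> 'a \<Rightarrow> bool"
  assumes nonempty: "M \<noteq> {}"
    and ge_refl: "reflp_on M ge"
    and ge_trans: "transp_on M ge"
    and ge_antisym: "antisymp_on M ge"

definition strictly_above :: "('a \<Rightarrow> 'a \<Rightarrow> bool) \<Rightarrow> 'a \<Rightarrow> 'a \<Rightarrow> bool" where
  "strictly_above ge x y \<longleftrightarrow> ge x y \<and> x \<noteq> y"

text \<open>The relation written with a bullet superscript: \<open>x\<close> is not dominated by \<open>y\<close>, which includes
  the case that \<open>x\<close> and \<open>y\<close> are incomparable.\<close>

definition not_dominated :: "('a \<Rightarrow> 'a \<Rightarrow> bool) \<Rightarrow> 'a \<Rightarrow> 'a \<Rightarrow> bool" where
  "not_dominated ge x y \<longleftrightarrow> \<not> ge y x"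

definition radial :: "'a set \<Rightarrow> ('a \<Rightarrow> 'a \<Rightarrow> real) \<Rightarrow> ('a \<Rightarrow> 'a \<Rightarrow> bool) \<Rightarrow> bool" where
  "radial M d ge \<longleftrightarrow>
    (\<forall>x\<in>M. \<forall>y\<in>M. \<forall>z\<in>M.
      (not_dominated ge x y \<and> strictly_above ge y z \<longrightarrow> d x z \<ge> d x y) \<and>
      (strictly_above ge x y \<and> not_dominated ge y z \<longrightarrow> d x z \<ge> d y z))"

definition geodesic_ray :: "'a set \<Rightarrow> ('a \<Rightarrow> 'a \<Rightarrow> real) \<Rightarrow> (real \<Rightarrow> 'a) \<Rightarrow> bool" where
  "geodesic_ray M d \<sigma> \<longleftrightarrow>
    \<sigma> \<in> {0..} \<rightarrow> M \<and> (\<forall>s\<ge>0. \<forall>t\<ge>0. d (\<sigma> s) (\<sigma> t) = \<bar>s - t\<bar>)"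

definition busemann :: "('a \<Rightarrow> 'a \<Rightarrow> real) \<Rightarrow> (real \<Rightarrow> 'a) \<Rightarrow> 'a \<Rightarrow> real" where
  "busemann d \<sigma> a = Lim at_top (\<lambda>t. d a (\<sigma> t) - t)"

text \<open>For a geodesic ray the limit exists: the function is eventually nonincreasing and bounded
  below.\<close>

lemma busemann_tendsto:
  assumes "Metric_space M d" and ray: "geodesic_ray M d \<sigma>" and a: "a \<in> M"
  shows "((\<lambda>t. d a (\<sigma> t) - t) \<longlongrightarrow> busemann d \<sigma> a) at_top"
proof -
  interpret Metric_space M d by fact
  define g where "g = (\<lambda>t. d a (\<sigma> t) - t)"
  have inM: "\<sigma> t \<in> M" if "t \<ge> 0" for t
    using ray that by (auto simp: geodesic_ray_def)
  have dist: "d (\<sigma> s) (\<sigma> t) = \<bar>s - t\<bar>" if "s \<ge> 0" "t \<ge> 0" for s t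
    using ray that by (auto simp: geodesic_ray_def)
  have anti: "g t \<le> g s" if "0 \<le> s" "s \<le> t" for s t
    using triangle[of a "\<sigma> s" "\<sigma> t"] a inM[of s] inM[of t] dist[of s t] that
    by (auto simp: g_def)
  have lower: "g t \<ge> - d a (\<sigma> 0)" if "t \<ge> 0" for t
    using triangle[of "\<sigma> 0" a "\<sigma> t"] a inM[of 0] inM[of t] dist[of 0 t] that commute[of a "\<sigma> 0"]
    by (auto simp: g_def)
  define L where "L = Inf (g ` {0..})"
  have bdd: "bdd_below (g ` {0..})"
    using lower by (auto intro!: bdd_belowI)
  have "(g \<longlongrightarrow> L) at_top"
  proof (rule order_tendstoI)
    fix u assume "u < L"
    have "u < g t" if "t \<ge> 0" for t
      using cInf_lower[OF _ bdd, of "g t"] that \<open>u < L\<close> by (auto simp: L_def)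
    then show "eventually (\<lambda>t. u < g t) at_top"
      by (auto intro: eventually_at_top_linorderI[of 0])
  next
    fix u assume "L < u"
    then obtain s where s: "s \<ge> 0" "g s < u"
      using cInf_lessD[of "g ` {0..}" u] by (auto simp: L_def)
    then have "g t < u" if "t \<ge> s" for t
      using anti[of s t] that by auto
    then show "eventually (\<lambda>t. g t < u) at_top"
      by (auto intro: eventually_at_top_linorderI[of s])
  qed
  moreover from this have "Lim at_top g = L"
    by (intro tendsto_Lim) auto
  ultimately show ?thesis
    by (simp add: busemann_def g_def)
qed

definition one_lipschitz_on ::
  "'a set \<Rightarrow> ('a \<Rightarrow> 'a \<Rightarrow> real) \<Rightarrow> ('b \<Rightarrow> 'b \<Rightarrow> real) \<Rightarrow> ('a \<Rightarrow> 'b) \<Rightarrow> bool" where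
  "one_lipschitz_on S d d' f \<longleftrightarrow> (\<forall>x\<in>S. \<forall>y\<in>S. d' (f x) (f y) \<le> d x y)"

text \<open>\<open>monotone_on S geX geY f\<close> says that \<open>geX x y\<close> implies \<open>geY (f x) (f y)\<close> for \<open>x, y\<close> in \<open>S\<close>.\<close>

definition monotone_lipschitz_extension_property ::
  "'a set \<Rightarrow> ('a \<Rightarrow> 'a \<Rightarrow> real) \<Rightarrow> ('a \<Rightarrow> 'a \<Rightarrow> bool) \<Rightarrow>
   'b set \<Rightarrow> ('b \<Rightarrow> 'b \<Rightarrow> real) \<Rightarrow> ('b \<Rightarrow> 'b \<Rightarrow> bool) \<Rightarrow> bool" where
  "monotone_lipschitz_extension_property X dX geX Y dY geY \<longleftrightarrow>
    (\<forall>S f. S \<noteq> {} \<and> S \<subseteq> X \<and> f \<in> S \<rightarrow> Y \<and>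
        monotone_on S geX geY f \<and> one_lipschitz_on S dX dY f \<longrightarrow>
      (\<exists>F. F \<in> X \<rightarrow> Y \<and> monotone_on X geX geY F \<and> one_lipschitz_on X dX dY F \<and>
        (\<forall>x\<in>S. F x = f x)))"

end

theory Submission
  imports Defs
begin

text \<open>
  Let \<open>d\<close> be the metric of \<open>X\<close>. If \<open>a\<close> is not dominated by \<open>b\<close>, then the map sending \<open>a\<close> to
  \<open>\<sigma> (d a b)\<close> and \<open>b\<close> to \<open>\<sigma> 0\<close> is an isometric embedding of \<open>{a, b}\<close> into the ray, and it
  preserves the order because \<open>\<sigma>\<close> is increasing. Extend it to all of \<open>X\<close> and follow it by
  \<open>- B\<^sub>\<sigma>\<close>, which is increasing by hypothesis, is 1-Lipschitz (\<open>busemann_one_lipschitz\<close>), and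
  takes \<open>\<sigma> s\<close> back to \<open>s\<close> (\<open>busemann_on_ray\<close>). The outcome is a real-valued increasing
  1-Lipschitz function \<open>u\<close> on \<open>X\<close> with \<open>u a - u b = d a b\<close>
  (\<open>increasing_lipschitz_function_attaining_distance\<close>).

  Such functions force radiality. Replacing \<open>a\<close> by some \<open>x\<close> above it, or \<open>b\<close> by some \<open>z\<close>
  below it, cannot shrink the gap \<open>u a - u b\<close>, while every gap is bounded by the distance of the
  two points. Hence \<open>d a z\<close>
  and \<open>d x b\<close> are both at least \<open>d a b\<close>, and these are the two inequalities of a radial order.
\<close>

lemma busemann_one_lipschitz:
  assumes "Metric_space M d" and ray: "geodesic_ray M d \<sigma>" and "a \<in> M" and "b \<in> M"
  shows "busemann d \<sigma> b - busemann d \<sigma> a \<le> d a b"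
proof -
  interpret Metric_space M d by fact
  have "((\<lambda>t. (d b (\<sigma> t) - t) - (d a (\<sigma> t) - t)) \<longlongrightarrow> busemann d \<sigma> b - busemann d \<sigma> a) at_top"
    by (intro tendsto_diff busemann_tendsto[OF assms(1) ray] assms)
  moreover have "eventually (\<lambda>t. (d b (\<sigma> t) - t) - (d a (\<sigma> t) - t) \<le> d a b) at_top"
  proof (rule eventually_at_top_linorderI[of 0])
    fix t :: real assume "t \<ge> 0"
    then have "\<sigma> t \<in> M"
      using ray by (auto simp: geodesic_ray_def)
    then show "(d b (\<sigma> t) - t) - (d a (\<sigma> t) - t) \<le> d a b"
      using triangle[of b a "\<sigma> t"] assms by (simp add: commute)
  qed
  ultimately show ?thesis
    by (intro tendsto_upperbound) auto
qed

lemma busemann_on_ray: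
  assumes "Metric_space M d" and ray: "geodesic_ray M d \<sigma>" and "s \<ge> 0"
  shows "busemann d \<sigma> (\<sigma> s) = - s"
proof -
  have "\<sigma> s \<in> M"
    using ray \<open>s \<ge> 0\<close> by (auto simp: geodesic_ray_def)
  then have "((\<lambda>t. d (\<sigma> s) (\<sigma> t) - t) \<longlongrightarrow> busemann d \<sigma> (\<sigma> s)) at_top"
    by (rule busemann_tendsto[OF assms(1) ray])
  moreover have "((\<lambda>t. d (\<sigma> s) (\<sigma> t) - t) \<longlongrightarrow> - s) at_top"
  proof (rule tendsto_eventually, rule eventually_at_top_linorderI[of s])
    fix t assume "s \<le> t"
    then show "d (\<sigma> s) (\<sigma> t) - t = - s"
      using ray \<open>s \<ge> 0\<close> by (auto simp: geodesic_ray_def)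
  qed
  ultimately show ?thesis
    by (intro tendsto_unique) auto
qed

text \<open>Two points suffice as the domain of the map to be extended: with \<open>a\<close> not dominated by \<open>b\<close>, the
  only order relation it has to preserve between distinct points is \<open>a\<close> above \<open>b\<close>, and for that
  \<open>a\<close> must go to the farther point of the ray. The sign of \<open>u\<close> is opposite to that of the Busemann
  function, which is decreasing and equals \<open>- s\<close> at \<open>\<sigma> s\<close>.\<close>

lemma increasing_lipschitz_function_attaining_distance:
  assumes "partially_ordered_metric_space X dX geX"
    and "partially_ordered_metric_space Y dY geY"
    and ray: "geodesic_ray Y dY \<sigma>"
    and increasing: "\<forall>s t. s \<ge> t \<and> t \<ge> 0 \<longrightarrow> geY (\<sigma> s) (\<sigma> t)"
    and decreasing: "monotone_on Y geY (\<le>) (busemann dY \<sigma>)"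
    and extension: "monotone_lipschitz_extension_property X dX geX Y dY geY"
    and ab: "a \<in> X" "b \<in> X" "not_dominated geX a b"
  shows "\<exists>u :: 'a \<Rightarrow> real. monotone_on X geX (\<ge>) u \<and>
    (\<forall>p\<in>X. \<forall>q\<in>X. u p - u q \<le> dX p q) \<and> u a - u b = dX a b"
proof -
  interpret X: partially_ordered_metric_space X dX geX by fact
  interpret Y: partially_ordered_metric_space Y dY geY by fact
  have Y: "Metric_space Y dY" by unfold_locales
  define r where "r = dX a b"
  define f where "f = (\<lambda>p. if p = a then \<sigma> r else \<sigma> 0)"
  have r: "r \<ge> 0"
    by (simp add: r_def)
  have neq: "a \<noteq> b"
    using ab X.ge_refl by (auto simp: not_dominated_def reflp_on_def)
  have "f \<in> {a, b} \<rightarrow> Y"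
    using ray r by (auto simp: f_def geodesic_ray_def)
  moreover have "monotone_on {a, b} geX geY f"
    using ab(3) neq r increasing by (auto simp: monotone_on_def f_def not_dominated_def)
  moreover have "one_lipschitz_on {a, b} dX dY f"
    using ray r by (auto simp: one_lipschitz_on_def f_def geodesic_ray_def r_def X.commute)
  ultimately have "\<exists>F. F \<in> X \<rightarrow> Y \<and> monotone_on X geX geY F \<and> one_lipschitz_on X dX dY F \<and>
      (\<forall>p\<in>{a, b}. F p = f p)"
    using extension[unfolded monotone_lipschitz_extension_property_def, rule_format, of "{a, b}" f]
      ab(1,2) by simp
  then obtain F where F: "F \<in> X \<rightarrow> Y" and mono: "monotone_on X geX geY F"
    and lip: "one_lipschitz_on X dX dY F" and Fab: "F a = \<sigma> r" "F b = \<sigma> 0"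
    using neq by (auto simp: f_def)
  define u where "u = (\<lambda>p. - busemann dY \<sigma> (F p))"
  have "monotone_on X geX (\<ge>) u"
  proof (rule monotone_onI)
    fix p q assume pq: "p \<in> X" "q \<in> X" "geX p q"
    then have "F p \<in> Y" "F q \<in> Y"
      using F by auto
    then show "u q \<le> u p"
      using monotone_onD[OF decreasing _ _ monotone_onD[OF mono pq]] by (simp add: u_def)
  qed
  moreover have "u p - u q \<le> dX p q" if pq: "p \<in> X" "q \<in> X" for p q
  proof -
    have FY: "F p \<in> Y" "F q \<in> Y"
      using F pq by auto
    have "u p - u q \<le> dY (F p) (F q)"
      using busemann_one_lipschitz[OF Y ray FY] by (simp add: u_def)
    also have "\<dots> \<le> dX p q"
      using lip pq by (simp add: one_lipschitz_on_def)
    finally show ?thesis .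
  qed
  moreover have "u a - u b = dX a b"
    using busemann_on_ray[OF Y ray] r by (simp add: u_def Fab r_def)
  ultimately show ?thesis
    by (intro exI[of _ u]) simp
qed

theorem theorem3:
  fixes X :: "'a set" and dX :: "'a \<Rightarrow> 'a \<Rightarrow> real" and geX :: "'a \<Rightarrow> 'a \<Rightarrow> bool"
    and Y :: "'b set" and dY :: "'b \<Rightarrow> 'b \<Rightarrow> real" and geY :: "'b \<Rightarrow> 'b \<Rightarrow> bool"
  assumes "partially_ordered_metric_space X dX geX"
    and "partially_ordered_metric_space Y dY geY"
    and "\<exists>\<sigma>. geodesic_ray Y dY \<sigma> \<and>
          (\<forall>s t. s \<ge> t \<and> t \<ge> 0 \<longrightarrow> geY (\<sigma> s) (\<sigma> t)) \<and>
          monotone_on Y geY (\<le>) (busemann dY \<sigma>)"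
    and "monotone_lipschitz_extension_property X dX geX Y dY geY"
  shows "radial X dX geX"
proof -
  obtain \<sigma> where \<sigma>: "geodesic_ray Y dY \<sigma>"
      "\<forall>s t. s \<ge> t \<and> t \<ge> 0 \<longrightarrow> geY (\<sigma> s) (\<sigma> t)"
      "monotone_on Y geY (\<le>) (busemann dY \<sigma>)"
    using assms(3) by blast
  note separate = increasing_lipschitz_function_attaining_distance[OF assms(1,2) \<sigma> assms(4)]
  show ?thesis
    unfolding radial_def
  proof (intro ballI conjI impI)
    fix x y z assume X: "x \<in> X" "y \<in> X" "z \<in> X"
    assume xyz: "not_dominated geX x y \<and> strictly_above geX y z"
    obtain u :: "'a \<Rightarrow> real"
      where u: "monotone_on X geX (\<ge>) u" "\<forall>p\<in>X. \<forall>q\<in>X. u p - u q \<le> dX p q"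
        "u x - u y = dX x y"
      using separate[OF X(1,2) conjunct1[OF xyz]] by auto
    have "u z \<le> u y"
      using monotone_onD[OF u(1)] X xyz by (simp add: strictly_above_def)
    moreover have "u x - u z \<le> dX x z"
      using u(2) X by blast
    ultimately show "dX x z \<ge> dX x y"
      using u(3) by linarith
  next
    fix x y z assume X: "x \<in> X" "y \<in> X" "z \<in> X"
    assume xyz: "strictly_above geX x y \<and> not_dominated geX y z"
    obtain u :: "'a \<Rightarrow> real"
      where u: "monotone_on X geX (\<ge>) u" "\<forall>p\<in>X. \<forall>q\<in>X. u p - u q \<le> dX p q"
        "u y - u z = dX y z"
      using separate[OF X(2,3) conjunct2[OF xyz]] by auto
    have "u y \<le> u x"
      using monotone_onD[OF u(1)] X xyz by (simp add: strictly_above_def)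
    moreover have "u x - u z \<le> dX x z"
      using u(2) X by blast
    ultimately show "dX x z \<ge> dX y z"
      using u(3) by linarith
  qed
qed

end
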